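(* Let $\mathbb{C}_s=\{\bm s\in\mathbb{S}: h(\bm s)\ge 0\}$ be non-empty and without isolated points. Suppose $h$ is a valid flow matching barrier function (with associated function $\varphi$) for the guided flow matching model $$\frac{\mathrm{d}\mathcal{T}_t}{\mathrm{d}t}=\bm v^{\bm\theta}_t(\mathcal{T}_t)+\bm u_t,\qquad t\in[0,1],\qquad \mathcal{T}_0\sim p_0 .$$ Suppose that for every $t\in[0,1)$ the term $\bm u_t=[(\bm u_t^0)^\top,\dots,(\bm u_t^H)^\top]^\top$ is chosen from $\mathbb{U}_t=\prod_{k=0}^H\mathbb{U}_t^k$, where for $k=0,\dots,H$ $$\mathbb{U}_t^k=\Big\{\bm u_t^k\in\mathbb{R}^{d_s}\ :\ \frac{\mathrm{d}h}{\mathrm{d}\bm s}(\bm E_k\mathcal{T}_t)\,\bm E_k\bm v_t^{\bm\theta}(\mathcal{T}_t)+\frac{\mathrm{d}h}{\mathrm{d}\bm s}(\bm E_k\mathcal{T}_t)\,\bm u_t^k+\varphi\big(t,h(\bm E_k\mathcal{T}_t)\big)\,h(\bm E_k\mathcal{T}_t)\ge 0\Big\}.$$ Then the flow matching process is safe: for every initial sample $\mathcal{T}_0\sim p_0$, the generated trajectory $\mathcal{T}_1$ satisfies $h(\bm E_k\mathcal{T}_1)\ge 0$ for all $k=0,\dots,H$.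
   Context: Setting. $d_s,H\in\mathbb{N}_{>0}$, $d=(H+1)d_s$, $\mathbb{S}\subseteq\mathbb{R}^{d_s}$ is the state space. A trajectory is a vector $\mathcal{T}=[(\bm s^0)^\top,\dots,(\bm s^H)^\top]^\top\in\mathbb{R}^d$ with $\bm s^k\in\mathbb{R}^{d_s}$. The selection matrices $\bm E_k=[\bm 0_{d_s\times kd_s},\bm I_{d_s},\bm 0_{d_s\times(H-k)d_s}]\in\mathbb{R}^{d_s\times d}$ satisfy $\bm s^k=\bm E_k\mathcal{T}$. The function $h:\mathbb{S}\to\mathbb{R}$ is continuously differentiable, with derivative $\mathrm{d}h/\mathrm{d}\bm s$ regarded as a row vector; it is understood that the states $\bm E_k\mathcal{T}_t$ at which $h$ is evaluated lie in $\mathbb{S}$. Guided flow matching. $\bm v^{\bm\theta}:[0,1]\times\mathbb{R}^d\to\mathbb{R}^d$ is a (learned) time-dependent vector field, $\bm v_t^{\bm\theta}=\bm v^{\bm\theta}(t,\cdot)$, $\bm u_t\in\mathbb{R}^d$ is a guidance (regularization) term with blocks $\bm u_t^k\in\mathbb{R}^{d_s}$, and $p_0$ is a prior distribution on $\mathbb{R}^d$ (possibly with unbounded support, so the initial sample need not be safe). For an initial sample $\mathcal{T}_0$, the curve $t\mapsto\mathcal{T}_t$ on $[0,1]$ is the solution of the guided ODE in the claim starting at $\mathcal{T}_0$; the generated trajectory is $\mathcal{T}_1$. Flow matching barrier function (FMBF). $h$ is a (valid) FMBF for the guided flow matching model if $$\sup_{\bm u_t^k\in\mathbb{R}^{d_s}}\Big\{\frac{\mathrm{d}h}{\mathrm{d}\bm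 s}(\bm E_k\mathcal{T}_t)\bm E_k\bm v_t^{\bm\theta}(\mathcal{T}_t)+\frac{\mathrm{d}h}{\mathrm{d}\bm s}(\bm E_k\mathcal{T}_t)\bm u_t^k+\varphi(t,h(\bm E_k\mathcal{T}_t))h(\bm E_k\mathcal{T}_t)\Big\}\ge 0$$ for all $k=0,\dots,H$ and $t\in[0,1)$, where $\varphi:[0,1)\times\mathbb{R}\to\mathbb{R}_{>0}$ has the form $\varphi(t,h)=\varphi_0$ if $h\ge 0$ and $\varphi(t,h)=\varphi_1(t)$ otherwise, with a constant $\varphi_0\in\mathbb{R}_{>0}$ and a monotonically increasing function $\varphi_1:[0,1)\to\mathbb{R}_{>0}$ satisfying $\int_0^{1^-}\varphi_1(s)\,\mathrm{d}s=\infty$. *)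

theory Defs
  imports "HOL-Probability.Probability"
begin

text \<open>
  The stacked space is \<open>real ^ ('k \<times> 'n)\<close>: the coordinate \<open>(k, i)\<close> is the \<open>i\<close>-th
  component of the \<open>k\<close>-th state. The finite type \<open>'k\<close> stands for the time steps \<open>0, \<dots>, H\<close>
  and \<open>'n\<close> for the state coordinates, so the dimension is \<open>CARD('k) * CARD('n)\<close>.
\<close>

definition selection_matrix :: "'k::finite \<Rightarrow> real ^ ('k \<times> 'n::finite) ^ 'n" where
  "selection_matrix k = (\<chi> i j. if j = (k, i) then 1 else 0)"

definition block :: "'k::finite \<Rightarrow> real ^ ('k \<times> 'n::finite) \<Rightarrow> real ^ 'n" where
  "block k x = selection_matrix k *v x"

lemma block_nth: "block k x $ i = x $ (k, i)"
  by (simp add: block_def selection_matrix_def matrix_vector_mult_def if_distrib[of "\<lambda>c. c * _"]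
      cong: if_cong)

text \<open>
  The row vector \<open>dh s\<close> acts on column vectors through the inner product. Derivatives are taken
  within \<open>S\<close>, which is an arbitrary subset; where the derivative within \<open>S\<close> is not unique,
  \<open>dh\<close> is any choice that is continuous on \<open>S\<close>.
\<close>

definition C1_on :: "(real ^ 'n::finite) set \<Rightarrow> (real ^ 'n \<Rightarrow> real) \<Rightarrow> (real ^ 'n \<Rightarrow> real ^ 'n) \<Rightarrow> bool"
  where
  "C1_on S h dh \<longleftrightarrow>
     (\<forall>s\<in>S. (h has_derivative (\<lambda>w. dh s \<bullet> w)) (at s within S)) \<and> continuous_on S dh"

definition safe_set :: "(real ^ 'n::finite) set \<Rightarrow> (real ^ 'n \<Rightarrow> real) \<Rightarrow> (real ^ 'n) set" where
  "safe_set S h = {s \<in> S. h s \<ge> 0}"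

definition barrier_rate :: "(real \<Rightarrow> real \<Rightarrow> real) \<Rightarrow> bool" where
  "barrier_rate \<phi> \<longleftrightarrow>
     (\<exists>\<phi>0 \<phi>1. \<phi>0 > 0 \<and> (\<forall>t\<in>{0..<1}. \<phi>1 t > 0) \<and> mono_on {0..<1} \<phi>1 \<and>
        filterlim (\<lambda>b. integral {0..b} \<phi>1) at_top (at_left 1) \<and>
        (\<forall>t\<in>{0..<1}. \<forall>y. \<phi> t y = (if y \<ge> 0 then \<phi>0 else \<phi>1 t)))"

text \<open>
  The barrier expression at time \<open>t\<close>, stacked state \<open>x\<close> and step \<open>k\<close>, as a function of the
  guidance block \<open>w\<close>.
\<close>

definition barrier_term ::
  "(real ^ 'n::finite \<Rightarrow> real) \<Rightarrow> (real ^ 'n \<Rightarrow> real ^ 'n) \<Rightarrow> (real \<Rightarrow> real \<Rightarrow> real) \<Rightarrow>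
   (real \<Rightarrow> real ^ ('k::finite \<times> 'n) \<Rightarrow> real ^ ('k \<times> 'n)) \<Rightarrow>
   real \<Rightarrow> real ^ ('k \<times> 'n) \<Rightarrow> 'k \<Rightarrow> real ^ 'n \<Rightarrow> real" where
  "barrier_term h dh \<phi> v t x k w =
     dh (block k x) \<bullet> block k (v t x) + dh (block k x) \<bullet> w
       + \<phi> t (h (block k x)) * h (block k x)"

text \<open>
  The set \<open>\<T>\<close> collects the curves generated by the model. The supremum may be infinite, hence it is
  taken in the extended reals.
\<close>

definition fmbf ::
  "(real ^ 'n::finite \<Rightarrow> real) \<Rightarrow> (real ^ 'n \<Rightarrow> real ^ 'n) \<Rightarrow> (real \<Rightarrow> real \<Rightarrow> real) \<Rightarrow>
   (real \<Rightarrow> real ^ ('k::finite \<times> 'n) \<Rightarrow> real ^ ('k \<times> 'n)) \<Rightarrow>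
   (real \<Rightarrow> real ^ ('k \<times> 'n)) set \<Rightarrow> bool" where
  "fmbf h dh \<phi> v \<T> \<longleftrightarrow> barrier_rate \<phi> \<and>
     (\<forall>T\<in>\<T>. \<forall>k. \<forall>t\<in>{0..<1}. (SUP w. ereal (barrier_term h dh \<phi> v t (T t) k w)) \<ge> 0)"

definition guidance_block_set ::
  "(real ^ 'n::finite \<Rightarrow> real) \<Rightarrow> (real ^ 'n \<Rightarrow> real ^ 'n) \<Rightarrow> (real \<Rightarrow> real \<Rightarrow> real) \<Rightarrow>
   (real \<Rightarrow> real ^ ('k::finite \<times> 'n) \<Rightarrow> real ^ ('k \<times> 'n)) \<Rightarrow>
   real \<Rightarrow> real ^ ('k \<times> 'n) \<Rightarrow> 'k \<Rightarrow> (real ^ 'n) set" where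
  "guidance_block_set h dh \<phi> v t x k = {w. barrier_term h dh \<phi> v t x k w \<ge> 0}"

definition guidance_set ::
  "(real ^ 'n::finite \<Rightarrow> real) \<Rightarrow> (real ^ 'n \<Rightarrow> real ^ 'n) \<Rightarrow> (real \<Rightarrow> real \<Rightarrow> real) \<Rightarrow>
   (real \<Rightarrow> real ^ ('k::finite \<times> 'n) \<Rightarrow> real ^ ('k \<times> 'n)) \<Rightarrow>
   real \<Rightarrow> real ^ ('k \<times> 'n) \<Rightarrow> (real ^ ('k \<times> 'n)) set" where
  "guidance_set h dh \<phi> v t x = {u. \<forall>k. block k u \<in> guidance_block_set h dh \<phi> v t x k}"

definition guided_flow ::
  "(real \<Rightarrow> real ^ 'd::finite \<Rightarrow> real ^ 'd) \<Rightarrow> (real \<Rightarrow> real ^ 'd) \<Rightarrow> real ^ 'd \<Rightarrow>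
   (real \<Rightarrow> real ^ 'd) \<Rightarrow> bool" where
  "guided_flow v u x0 T \<longleftrightarrow> T 0 = x0 \<and>
     (\<forall>t\<in>{0..1}. (T has_vector_derivative v t (T t) + u t) (at t within {0..1}))"

end

theory Submission
  imports Defs
begin

text \<open>
  Along a block of the flow, \<open>y t = h (E\<^sub>k T\<^sub>t)\<close> satisfies \<open>y' \<ge> - \<phi>(t, y) y\<close> on \<open>[0, 1)\<close>.
  While \<open>y < 0\<close> the right-hand side is positive, so \<open>y\<close> increases there; hence \<open>y\<close> cannot be
  negative at time 1 once it has been nonnegative. If \<open>y\<close> were negative on all of \<open>[0, 1]\<close>, then
  \<open>(ln (- y))' \<le> - \<phi>\<^sub>1\<close>, so \<open>\<integral>\<phi>\<^sub>1\<close> over \<open>[0, b]\<close> would stay below \<open>ln (- y 0) - ln (- y 1)\<close>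
  for all \<open>b < 1\<close>, contradicting its divergence.
\<close>

lemma barrier_rate_pos:
  assumes "barrier_rate \<phi>" "t \<in> {0..<1}"
  shows "\<phi> t y > 0"
proof -
  obtain \<phi>0 \<phi>1 where "\<phi>0 > 0" "\<phi>1 t > 0" "\<phi> t y = (if y \<ge> 0 then \<phi>0 else \<phi>1 t)"
    using assms unfolding barrier_rate_def by blast
  then show ?thesis by simp
qed

text \<open>Where \<open>y < 0\<close>, the inequality forces
  \<open>y' \<ge> - \<phi> t (y t) * y t > 0\<close>. By the mean value theorem the sign of
  \<open>y'\<close> matters only in the open interval, so \<open>a\<close> may be a time at which
  \<open>y\<close> is still nonnegative, and \<open>b\<close> may be 1, where the inequality is not
  assumed.\<close>

lemma nondecreasing_while_negative:
  fixes y y' :: "real \<Rightarrow> real"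
  assumes rate: "barrier_rate \<phi>"
    and deriv: "\<And>t. t \<in> {0..1} \<Longrightarrow> (y has_real_derivative y' t) (at t within {0..1})"
    and ineq: "\<And>t. t \<in> {0..<1} \<Longrightarrow> 0 \<le> y' t + \<phi> t (y t) * y t"
    and "0 \<le> a" "a \<le> b" "b \<le> 1"
    and neg: "\<And>t. a < t \<Longrightarrow> t < b \<Longrightarrow> y t < 0"
  shows "y a \<le> y b"
  using \<open>a \<le> b\<close>
proof (rule DERIV_nonneg_imp_increasing_open)
  fix t assume t: "a < t" "t < b"
  with assms(4-6) have t01: "0 < t" "t < 1" by auto
  have "(y has_real_derivative y' t) (at t)"
    using deriv[of t] t01 by (simp add: at_within_Icc_at)
  moreover have "\<phi> t (y t) > 0"
    using barrier_rate_pos[OF rate] t01 by simp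
  then have "\<phi> t (y t) * y t < 0"
    using neg[OF t] by (simp add: mult_pos_neg)
  then have "0 \<le> y' t"
    using ineq[of t] t01 by simp
  ultimately show "\<exists>d. DERIV y t :> d \<and> 0 \<le> d" by blast
next
  have "continuous_on {0..1} y"
    using deriv by (meson DERIV_continuous_on)
  then show "continuous_on {a..b} y"
    by (rule continuous_on_subset) (use assms(4-6) in auto)
qed

text \<open>Dividing the inequality by \<open>y t < 0\<close> reverses it to
  \<open>\<phi>1 t \<le> - (y' t / y t)\<close>, and the right-hand side is the derivative of
  \<open>- ln (- y t)\<close>.\<close>

lemma negative_forever_integral_le:
  fixes y y' :: "real \<Rightarrow> real"
  assumes deriv: "\<And>t. t \<in> {0..b} \<Longrightarrow> (y has_real_derivative y' t) (at t within {0..b})"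
    and ineq: "\<And>t. t \<in> {0..b} \<Longrightarrow> 0 \<le> y' t + \<phi>1 t * y t"
    and neg: "\<And>t. t \<in> {0..b} \<Longrightarrow> y t < 0"
    and int: "\<phi>1 integrable_on {0..b}"
    and "0 \<le> b"
  shows "integral {0..b} \<phi>1 \<le> ln (- y 0) - ln (- y b)"
proof -
  define g where "g t = - ln (- y t)" for t
  have "((\<lambda>t. - (y' t / y t)) has_integral g b - g 0) {0..b}"
  proof (rule fundamental_theorem_of_calculus[OF \<open>0 \<le> b\<close>])
    fix t assume t: "t \<in> {0..b}"
    show "(g has_vector_derivative - (y' t / y t)) (at t within {0..b})"
      unfolding g_def has_real_derivative_iff_has_vector_derivative[symmetric]
      using deriv[OF t] neg[OF t]
      by (auto intro!: derivative_eq_intros simp: field_simps)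
  qed
  moreover have "\<phi>1 t \<le> - (y' t / y t)" if "t \<in> {0..b}" for t
    using ineq[OF that] neg[OF that] by (simp add: field_simps)
  ultimately have "integral {0..b} \<phi>1 \<le> g b - g 0"
    using int by (meson has_integral_le integrable_integral)
  then show ?thesis by (simp add: g_def)
qed

lemma barrier_comparison:
  fixes y y' :: "real \<Rightarrow> real"
  assumes rate: "barrier_rate \<phi>"
    and deriv: "\<And>t. t \<in> {0..1} \<Longrightarrow> (y has_real_derivative y' t) (at t within {0..1})"
    and ineq: "\<And>t. t \<in> {0..<1} \<Longrightarrow> 0 \<le> y' t + \<phi> t (y t) * y t"
  shows "0 \<le> y 1"
proof (rule ccontr)
  assume "\<not> 0 \<le> y 1"
  then have y1: "y 1 < 0" by simp
  have neg: "y t < 0" if t: "t \<in> {0..1}" for t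
  proof (rule ccontr)
    assume "\<not> y t < 0"
    then have yt: "y t \<ge> 0" by simp
    \<comment> \<open>\<open>Sup A\<close> is the last time with \<open>y \<ge> 0\<close>; it is
      attained because \<open>A\<close> is closed. After it \<open>y\<close> is negative, hence
      nondecreasing up to time 1, so \<open>y 1\<close> inherits the sign of
      \<open>y (Sup A)\<close>.\<close>
    define A where "A = {0..1} \<inter> y -` {0..}"
    have "continuous_on {0..1} y"
      using deriv by (meson DERIV_continuous_on)
    then have "closed A"
      unfolding A_def by (rule continuous_closed_preimage) simp_all
    moreover have "A \<noteq> {}" "bdd_above A"
      using t yt unfolding A_def by (auto intro!: bdd_aboveI[of _ 1])
    ultimately have SupA: "Sup A \<in> A"
      by (meson closed_contains_Sup)
    have "y r < 0" if "Sup A < r" "r < 1" for r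
      using that cSup_upper[OF _ \<open>bdd_above A\<close>, of r] SupA unfolding A_def by force
    then have "y (Sup A) \<le> y 1"
      using nondecreasing_while_negative[OF rate deriv ineq, of "Sup A" 1] SupA
      unfolding A_def by auto
    then show False
      using SupA y1 unfolding A_def by auto
  qed
  obtain \<phi>0 \<phi>1 where mono: "mono_on {0..<1} \<phi>1"
    and lim: "filterlim (\<lambda>b. integral {0..b} \<phi>1) at_top (at_left (1::real))"
    and \<phi>: "\<And>t y. t \<in> {0..<1} \<Longrightarrow> \<phi> t y = (if y \<ge> 0 then \<phi>0 else \<phi>1 t)"
    using rate unfolding barrier_rate_def by metis
  have "integral {0..b} \<phi>1 \<le> ln (- y 0) - ln (- y 1)" if b: "0 < b" "b < 1" for b
  proof -
    have "integral {0..b} \<phi>1 \<le> ln (- y 0) - ln (- y b)"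
    proof (rule negative_forever_integral_le)
      show "(y has_real_derivative y' t) (at t within {0..b})" if "t \<in> {0..b}" for t
        using deriv[of t] that b by (auto intro: DERIV_subset)
      show "0 \<le> y' t + \<phi>1 t * y t" "y t < 0" if "t \<in> {0..b}" for t
        using ineq[of t] \<phi>[of t "y t"] neg[of t] that b by auto
      \<comment> \<open>Monotonicity gives integrability only on compact subintervals of [0, 1), as
        \<open>\<phi>1\<close> may blow up at 1; hence \<open>b < 1\<close>.\<close>
      show "\<phi>1 integrable_on {0..b}"
        by (rule integrable_on_mono_on) (use mono b in \<open>auto intro: mono_on_subset\<close>)
    qed (use b in simp)
    \<comment> \<open>This makes the bound on the integral independent of \<open>b\<close>.\<close>
    moreover have "y b \<le> y 1"
      using nondecreasing_while_negative[OF rate deriv ineq, of b 1] neg b by auto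
    then have "ln (- y 1) \<le> ln (- y b)"
      using y1 by simp
    ultimately show ?thesis by simp
  qed
  moreover have "\<forall>\<^sub>F b in at_left 1. 0 < b \<and> b < (1::real)"
    by (auto simp: eventually_at_left_field intro!: exI[of _ 0])
  ultimately have "\<forall>\<^sub>F b in at_left (1::real). integral {0..b} \<phi>1 \<le> ln (- y 0) - ln (- y 1)"
    by (auto elim: eventually_mono)
  moreover have "\<forall>\<^sub>F b in at_left (1::real). ln (- y 0) - ln (- y 1) < integral {0..b} \<phi>1"
    using lim by (simp add: filterlim_at_top_dense)
  \<comment> \<open>Contradictory because \<open>at_left 1\<close> is not the trivial
    filter.\<close>
  ultimately have "\<forall>\<^sub>F b in at_left (1::real). False"
    by eventually_elim simp
  then show False
    by simp
qed

lemma bounded_linear_block: "bounded_linear (block k)"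
  unfolding block_def by (rule matrix_vector_mul_bounded_linear)

text \<open>The chain rule needs the derivative of \<open>h\<close> only within the image of the
  curve. That image lies in \<open>S\<close>, so any derivative within \<open>S\<close>, unique or
  not, restricts to it.\<close>

lemma has_real_derivative_along_block:
  assumes "C1_on S h dh"
    and T: "(T has_vector_derivative x) (at t within A)" "t \<in> A"
    and S: "\<And>r. r \<in> A \<Longrightarrow> block k (T r) \<in> S"
  shows "((\<lambda>r. h (block k (T r))) has_real_derivative dh (block k (T t)) \<bullet> block k x) (at t within A)"
proof -
  have "(h has_derivative (\<lambda>w. dh (block k (T t)) \<bullet> w)) (at (block k (T t)) within S)"
    using assms(1) S[OF T(2)] unfolding C1_on_def by blast
  then have "(h has_derivative (\<lambda>w. dh (block k (T t)) \<bullet> w))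
      (at (block k (T t)) within (\<lambda>r. block k (T r)) ` A)"
    by (rule has_derivative_subset) (use S in auto)
  moreover have "((\<lambda>r. block k (T r)) has_derivative (\<lambda>r. r *\<^sub>R block k x)) (at t within A)"
    using bounded_linear.has_vector_derivative[OF bounded_linear_block T(1)]
    unfolding has_vector_derivative_def .
  ultimately have "((\<lambda>r. h (block k (T r))) has_derivative
      (\<lambda>r. dh (block k (T t)) \<bullet> (r *\<^sub>R block k x))) (at t within A)"
    by (rule has_derivative_in_compose[rotated])
  then show ?thesis
    by (simp add: has_field_derivative_def mult.commute[of _ "_ \<bullet> _"] mult_commute_abs)
qed

theorem theorem1:
  fixes H :: nat
    and S :: "(real ^ 'n::finite) set"
    and h :: "real ^ 'n \<Rightarrow> real"
    and dh :: "real ^ 'n \<Rightarrow> real ^ 'n"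
    and \<phi> :: "real \<Rightarrow> real \<Rightarrow> real"
    and v :: "real \<Rightarrow> real ^ ('k::finite \<times> 'n) \<Rightarrow> real ^ ('k \<times> 'n)"
    and p0 :: "(real ^ ('k \<times> 'n)) measure"
    and \<Omega> :: "'w measure"
    and T0 :: "'w \<Rightarrow> real ^ ('k \<times> 'n)"
    and u :: "'w \<Rightarrow> real \<Rightarrow> real ^ ('k \<times> 'n)"
    and T :: "'w \<Rightarrow> real \<Rightarrow> real ^ ('k \<times> 'n)"
  assumes "H > 0" and "CARD('k) = H + 1"
    and "C1_on S h dh"
    and "safe_set S h \<noteq> {}"
    and "\<not> (\<exists>s. s isolated_in safe_set S h)"
    and "prob_space \<Omega>" and "T0 \<in> borel_measurable \<Omega>" and "distr \<Omega> borel T0 = p0"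
    and "\<forall>\<omega>\<in>space \<Omega>. guided_flow v (u \<omega>) (T0 \<omega>) (T \<omega>)"
    and "\<forall>\<omega>\<in>space \<Omega>. \<forall>t\<in>{0..1}. \<forall>k. block k (T \<omega> t) \<in> S"
    and "fmbf h dh \<phi> v (T ` space \<Omega>)"
    and "\<forall>\<omega>\<in>space \<Omega>. \<forall>t\<in>{0..<1}. u \<omega> t \<in> guidance_set h dh \<phi> v t (T \<omega> t)"
  shows "\<forall>\<omega>\<in>space \<Omega>. \<forall>k. h (block k (T \<omega> 1)) \<ge> 0"
proof (intro ballI allI)
  fix \<omega> k assume \<omega>: "\<omega> \<in> space \<Omega>"
  define y' where "y' t = dh (block k (T \<omega> t)) \<bullet> block k (v t (T \<omega> t) + u \<omega> t)" for t
  show "0 \<le> h (block k (T \<omega> 1))"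
  proof (rule barrier_comparison[where y = "\<lambda>t. h (block k (T \<omega> t))" and y' = y'])
    show "barrier_rate \<phi>"
      using assms(11) unfolding fmbf_def by blast
    show "((\<lambda>t. h (block k (T \<omega> t))) has_real_derivative y' t) (at t within {0..1})"
      if "t \<in> {0..1}" for t
      unfolding y'_def
      by (rule has_real_derivative_along_block[OF assms(3)])
        (use assms(9,10) \<omega> that in \<open>auto simp: guided_flow_def\<close>)
    \<comment> \<open>Additivity of \<open>block k\<close> and of the inner product splits
      \<open>y' t\<close> into the drift and guidance terms, which turns membership in
      \<open>guidance_set\<close> into this inequality.\<close>
    show "0 \<le> y' t + \<phi> t (h (block k (T \<omega> t))) * h (block k (T \<omega> t))" if "t \<in> {0..<1}" for t
      using assms(12) \<omega> that
      by (auto simp: guidance_set_def guidance_block_set_def barrier_term_def y'_def inner_add_right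
          bounded_linear.linear[OF bounded_linear_block, THEN linear_add])
  qed
qed

end
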